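(* Let $N$ be a positive integer and $n=N+1$, let $f:(0,\infty)\to\mathbb{R}$ be a positive-valued function such that $x\mapsto xf(x)$ is decreasing and differentiable, and let $A>0$ and masses $m_1,\dots,m_n>0$ be fixed. Consider the system $$\ddot q_i=\sum_{j=1,\ j\neq i}^{n} m_j(q_j-q_i)\,f(\|q_j-q_i\|),\qquad i\in\{1,\dots,n\},\quad q_i\in\mathbb{R}^2 .$$ Then for every order of the masses there exists at most one equivalence class of relative equilibria of this system, with rotation constant $A$ and center of mass $Q_M=0$, for which $q_1,\dots,q_N$ lie on a circle with the origin at its center and $q_{N+1}=0$. That is: if $(q_1,\dots,q_n)$ and $(q_1',\dots,q_n')$ are two such relative equilibria with the same masses $m_1,\dots,m_n$, the same $A$, and the same order of the masses on their circles, then they are equivalent under a rotation.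
   Context: $\|\cdot\|$ is the Euclidean norm on $\mathbb{R}^2$ and $T(t)=\begin{pmatrix}\cos t&-\sin t\\ \sin t&\cos t\end{pmatrix}$. A relative equilibrium (with rotation constant $A>0$) is a solution of the system of the form $q_i(t)=T(At)(Q_i-Q_M)+Q_M$, $i\in\{1,\dots,n\}$, where $Q_1,\dots,Q_n\in\mathbb{R}^2$ are constant and $Q_M=\frac1M\sum_{k=1}^n m_kQ_k$, $M=\sum_{k=1}^n m_k$, is the center of mass. The points are pairwise distinct (no collisions), and circles have positive radius. Order of the masses: given a permutation $\tau$ of $\{1,\dots,N\}$, a relative equilibrium of the kind considered has the masses in the order $\tau$ if, after a rotation, $Q_{\tau(k)}=r(\cos\alpha_k,\sin\alpha_k)^T$ for $k=1,\dots,N$ with $r>0$ and $0\le\alpha_1<\alpha_2<\dots<\alpha_N<2\pi$ (i.e. $\tau$ records the order in which the labelled masses $m_1,\dots,m_N$ are met going counterclockwise around the circle; $m_{N+1}$ is at the center). Equivalence: two relative equilibria $(q_i)$ and $(q_i')$ are equivalent (in the same equivalence class) if there is a constant $c\in\mathbb{R}$ with $q_i'=T(c)q_i$ for all $i$. Scalings are not included in the equivalence. *)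

theory Defs
  imports "HOL-Analysis.Analysis"
begin

definition rot :: "real \<Rightarrow> real^2^2" where
  "rot t = vector [vector [cos t, - sin t], vector [sin t, cos t]]"

text \<open>Bodies are indexed by \<^term>\<open>{1..n}\<close>; values of \<^term>\<open>q\<close> and \<^term>\<open>m\<close> at other
  indices, and values of \<^term>\<open>f\<close> outside the positive reals, play no role.\<close>

definition solves_n_body ::
  "(real \<Rightarrow> real) \<Rightarrow> (nat \<Rightarrow> real) \<Rightarrow> nat \<Rightarrow> (nat \<Rightarrow> real \<Rightarrow> real^2) \<Rightarrow> bool" where
  "solves_n_body f m n q \<longleftrightarrow>
     (\<forall>t. inj_on (\<lambda>i. q i t) {1..n}) \<and>
     (\<exists>v. \<forall>i\<in>{1..n}. \<forall>t.
        (q i has_vector_derivative v i t) (at t) \<and>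
        (v i has_vector_derivative
           (\<Sum>j\<in>{1..n} - {i}. (m j * f (norm (q j t - q i t))) *\<^sub>R (q j t - q i t))) (at t))"

definition center_of_mass :: "(nat \<Rightarrow> real) \<Rightarrow> nat \<Rightarrow> (nat \<Rightarrow> real^2) \<Rightarrow> real^2" where
  "center_of_mass m n Q = (1 / (\<Sum>k=1..n. m k)) *\<^sub>R (\<Sum>k=1..n. m k *\<^sub>R Q k)"

text \<open>\<^term>\<open>Q\<close> is the constant configuration generating \<^term>\<open>q\<close>; it is determined on
  \<^term>\<open>{1..n}\<close> by \<^term>\<open>q\<close>, being its value at time 0.\<close>

definition relative_equilibrium ::
  "(real \<Rightarrow> real) \<Rightarrow> (nat \<Rightarrow> real) \<Rightarrow> nat \<Rightarrow> real \<Rightarrow> (nat \<Rightarrow> real^2) \<Rightarrow>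
   (nat \<Rightarrow> real \<Rightarrow> real^2) \<Rightarrow> bool" where
  "relative_equilibrium f m n A Q q \<longleftrightarrow>
     solves_n_body f m n q \<and>
     (\<forall>i\<in>{1..n}. \<forall>t.
        q i t = rot (A * t) *v (Q i - center_of_mass m n Q) + center_of_mass m n Q)"

definition on_centered_circle :: "nat \<Rightarrow> (nat \<Rightarrow> real \<Rightarrow> real^2) \<Rightarrow> bool" where
  "on_centered_circle N q \<longleftrightarrow> (\<exists>r>0. \<forall>i\<in>{1..N}. \<forall>t. q i t \<in> sphere 0 r)"

definition has_order :: "(nat \<Rightarrow> nat) \<Rightarrow> nat \<Rightarrow> (nat \<Rightarrow> real^2) \<Rightarrow> bool" where
  "has_order \<tau> N Q \<longleftrightarrow>
     (\<exists>c r \<alpha>. r > 0 \<and> strict_mono_on {1..N} \<alpha> \<and> (\<forall>k\<in>{1..N}. 0 \<le> \<alpha> k \<and> \<alpha> k < 2 * pi) \<and>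
        (\<forall>k\<in>{1..N}. rot c *v Q (\<tau> k) = r *\<^sub>R vector [cos (\<alpha> k), sin (\<alpha> k)]))"

definition rotation_equivalent ::
  "nat \<Rightarrow> (nat \<Rightarrow> real \<Rightarrow> real^2) \<Rightarrow> (nat \<Rightarrow> real \<Rightarrow> real^2) \<Rightarrow> bool" where
  "rotation_equivalent n q q' \<longleftrightarrow> (\<exists>c. \<forall>i\<in>{1..n}. \<forall>t. q' i t = rot c *v q i t)"

end

theory Submission
  imports Defs
begin

text \<open>
  Put \<open>g x = x f x\<close>. Two bodies on the circle of radius \<open>r\<close> at angular distance \<open>2 t\<close> are
  \<open>D = 2 r sin t\<close> apart; the force between them has radial part \<open>g D sin t\<close> and tangential part
  \<open>g D cos t\<close>. Given a second configuration \<open>(r', t')\<close>, concavity of \<open>sin\<close> on \<open>[0, \<pi>]\<close> gives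
  \<open>D' - D \<le> 2 (r' - r) sin t + 2 r' cos t (t' - t)\<close> and the same with the roles exchanged.
  Inserted into \<open>(g D' - g D) (D' - D) \<le> 0\<close> and summed over all pairs with weights
  \<open>m\<^sub>i m\<^sub>j\<close>, the terms in \<open>t' - t\<close> vanish by the tangential equations of motion, and the radial
  equations turn the remaining terms into at least a positive multiple of \<open>A\<^sup>2 (r' - r)\<^sup>2\<close>. Hence \<open>r' = r\<close>,
  and strict concavity of \<open>sin\<close> forces all angular distances to agree.
\<close>

section \<open>Rotations, unit vectors and force components on a circle\<close>

definition unit_vec :: "real \<Rightarrow> real^2" where
  "unit_vec a = vector [cos a, sin a]"

text \<open>Here \<open>t\<close> is half the signed angle from the attracted body to the attracting
  one. The absolute value and the factors \<open>(sin t)\<^sup>2\<close> and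
  \<open>sin (2 * t)\<close> serve both signs at once: the radial part is even in \<open>t\<close>,
  the tangential part odd.\<close>

definition radial_force :: "(real \<Rightarrow> real) \<Rightarrow> real \<Rightarrow> real \<Rightarrow> real" where
  "radial_force f r t = 2 * r * (sin t)\<^sup>2 * f (2 * r * \<bar>sin t\<bar>)"

definition tangential_force :: "(real \<Rightarrow> real) \<Rightarrow> real \<Rightarrow> real \<Rightarrow> real" where
  "tangential_force f r t = r * sin (2 * t) * f (2 * r * \<bar>sin t\<bar>)"

lemma inner_unit_vec: "unit_vec a \<bullet> unit_vec b = cos (a - b)"
  by (simp add: unit_vec_def inner_vec_def sum_2 cos_diff)

lemma rot_unit_vec: "rot c *v unit_vec a = unit_vec (a + c)"
  by (simp add: rot_def unit_vec_def vec_eq_iff matrix_vector_mult_def forall_2 sum_2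
      cos_add sin_add algebra_simps)

lemma rot_rot: "rot a *v (rot b *v x) = rot (a + b) *v x"
  by (simp add: rot_def vec_eq_iff matrix_vector_mult_def forall_2 sum_2
      cos_add sin_add algebra_simps)

lemma rot_0: "rot 0 *v x = x"
  by (simp add: rot_def vec_eq_iff matrix_vector_mult_def forall_2 sum_2)

text \<open>Confines the angle to two scalar coefficients, so that differentiating a rotating vector
  needs only the derivatives of \<open>cos\<close> and \<open>sin\<close>.\<close>

lemma rot_mult_vec: "rot t *v x = cos t *\<^sub>R x + sin t *\<^sub>R (rot (pi / 2) *v x)"
  by (simp add: rot_def vec_eq_iff matrix_vector_mult_def forall_2 sum_2)

lemma rot_eq_unit_vec:
  assumes "rot c *v x = r *\<^sub>R vector [cos a, sin a]"
  shows "x = r *\<^sub>R unit_vec (a - c)"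
proof -
  have "x = rot (- c) *v (rot c *v x)"
    by (simp add: rot_rot rot_0)
  also have "\<dots> = r *\<^sub>R (rot (- c) *v unit_vec a)"
    using assms by (simp add: unit_vec_def scaleR_matrix_vector_assoc matrix_vector_mult_scaleR)
  finally show ?thesis
    by (simp add: rot_unit_vec)
qed

lemma cos_double_half: "cos (x::real) = 1 - 2 * (sin (x / 2))\<^sup>2"
  using cos_double_sin[of "x / 2"] by simp

lemma norm_unit_vec_diff:
  assumes "r \<ge> 0"
  shows "norm (r *\<^sub>R unit_vec b - r *\<^sub>R unit_vec a) = 2 * r * \<bar>sin ((b - a) / 2)\<bar>"
proof -
  have "(norm (r *\<^sub>R unit_vec b - r *\<^sub>R unit_vec a))\<^sup>2 = r\<^sup>2 * (2 - 2 * cos (b - a))"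
    using cos_minus[of "b - a"] unfolding power2_norm_eq_inner
    by (simp add: inner_diff inner_unit_vec algebra_simps power2_eq_square)
  also have "\<dots> = (2 * r * \<bar>sin ((b - a) / 2)\<bar>)\<^sup>2"
    by (simp add: cos_double_half[of "b - a"] power_mult_distrib algebra_simps)
  finally show ?thesis
    by (rule power2_eq_imp_eq) (use assms in simp_all)
qed

section \<open>From the equations of motion to balance equations on the circle\<close>

lemma has_vector_derivative_rot:
  "((\<lambda>t. rot (A * t) *v x) has_vector_derivative A *\<^sub>R (rot (A * t + pi / 2) *v x)) (at t)"
proof -
  have "((\<lambda>t. cos (A * t) *\<^sub>R x + sin (A * t) *\<^sub>R (rot (pi / 2) *v x)) has_vector_derivative
      A *\<^sub>R (cos (A * t + pi / 2) *\<^sub>R x + sin (A * t + pi / 2) *\<^sub>R (rot (pi / 2) *v x))) (at t)"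
    by (auto intro!: derivative_eq_intros simp: cos_add sin_add scaleR_right_diff_distrib mult.commute)
  then show ?thesis
    by (simp flip: rot_mult_vec)
qed

text \<open>Two derivatives of a uniformly rotating vector give the factor \<open>A\<^sup>2\<close>
  and two quarter turns, hence a minus sign. Comparing accelerations at time 0 makes the
  differential equations algebraic.\<close>

lemma relative_equilibrium_eq:
  assumes "relative_equilibrium f m n A Q q" "center_of_mass m n Q = 0" "i \<in> {1..n}"
  shows "(\<Sum>j\<in>{1..n} - {i}. (m j * f (norm (Q j - Q i))) *\<^sub>R (Q j - Q i)) = - (A\<^sup>2 *\<^sub>R Q i)"
proof -
  have q: "q j = (\<lambda>t. rot (A * t) *v Q j)" if "j \<in> {1..n}" for j
    using assms that by (auto simp: relative_equilibrium_def)
  obtain v where v: "\<And>t. (q i has_vector_derivative v i t) (at t)"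
      "\<And>t. (v i has_vector_derivative
         (\<Sum>j\<in>{1..n} - {i}. (m j * f (norm (q j t - q i t))) *\<^sub>R (q j t - q i t))) (at t)"
    using assms unfolding relative_equilibrium_def solves_n_body_def by blast
  \<comment> \<open>The velocity \<open>v\<close> is known only to exist; uniqueness of derivatives
    identifies it with the explicit one.\<close>
  have "v i t = A *\<^sub>R (rot (A * t + pi / 2) *v Q i)" for t
    using v(1)[of t] unfolding q[OF assms(3)]
    by (rule vector_derivative_unique_at) (rule has_vector_derivative_rot)
  then have "v i = (\<lambda>t. A *\<^sub>R (rot (A * t) *v (rot (pi / 2) *v Q i)))"
    by (simp add: fun_eq_iff rot_rot)
  then have "(v i has_vector_derivative
      A *\<^sub>R A *\<^sub>R (rot (A * 0 + pi / 2) *v (rot (pi / 2) *v Q i))) (at 0)"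
    by (auto intro!: derivative_eq_intros has_vector_derivative_rot)
  then have "(v i has_vector_derivative - (A\<^sup>2 *\<^sub>R Q i)) (at 0)"
    by (simp add: rot_rot rot_mult_vec[of pi] power2_eq_square)
  from vector_derivative_unique_at[OF v(2)[of 0] this]
  have "(\<Sum>j\<in>{1..n} - {i}. (m j * f (norm (q j 0 - q i 0))) *\<^sub>R (q j 0 - q i 0))
      = - (A\<^sup>2 *\<^sub>R Q i)" .
  moreover have "q j 0 = Q j" if "j \<in> {1..n}" for j
    using q[OF that] by (simp add: rot_0)
  ultimately show ?thesis
    using assms(3) by simp
qed

text \<open>These are the projections of the vector equation for body \<open>\<tau> k\<close> onto
  the outward direction \<open>unit_vec (a k)\<close> and onto its quarter turn. The central body
  pulls along the radius, so it enters only the first. Reindexing by \<open>\<tau>\<close> replaces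
  labels by positions along the circle.\<close>

lemma circle_equations:
  assumes equil: "relative_equilibrium f m (N+1) A Q q" "center_of_mass m (N+1) Q = 0"
    and centre: "\<And>t. q (N+1) t = 0"
    and perm: "\<tau> permutes {1..N}" and "r > 0"
    and polar: "\<And>k. k \<in> {1..N} \<Longrightarrow> Q (\<tau> k) = r *\<^sub>R unit_vec (a k)"
    and k: "k \<in> {1..N}"
  shows "(\<Sum>l\<in>{1..N} - {k}. m (\<tau> l) * radial_force f r ((a l - a k) / 2))
           = A\<^sup>2 * r - m (N+1) * (r * f r)"
    and "(\<Sum>l\<in>{1..N} - {k}. m (\<tau> l) * tangential_force f r ((a l - a k) / 2)) = 0"
proof -
  define F where "F j = (m j * f (norm (Q j - Q (\<tau> k)))) *\<^sub>R (Q j - Q (\<tau> k))" for j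
  have \<tau>k: "\<tau> k \<in> {1..N}"
    using permutes_in_image[OF perm] k by blast
  have "q (N+1) 0 = rot (A * 0) *v Q (N+1)"
    using equil by (auto simp: relative_equilibrium_def)
  then have Q0: "Q (N+1) = 0"
    using centre by (simp add: rot_0)
  have "{1..N+1} - {\<tau> k} = insert (N+1) ({1..N} - {\<tau> k})"
    using \<tau>k by auto
  then have "- (A\<^sup>2 *\<^sub>R Q (\<tau> k)) = F (N+1) + (\<Sum>j\<in>{1..N} - {\<tau> k}. F j)"
    using relative_equilibrium_eq[OF equil, of "\<tau> k"] \<tau>k by (simp add: F_def)
  also have "(\<Sum>j\<in>{1..N} - {\<tau> k}. F j) = (\<Sum>l\<in>{1..N} - {k}. F (\<tau> l))"
  proof (rule sum.reindex_bij_betw[symmetric])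
    show "bij_betw \<tau> ({1..N} - {k}) ({1..N} - {\<tau> k})"
      using bij_betw_DiffI[OF permutes_imp_bij[OF perm], of "{k}" "{\<tau> k}"] k \<tau>k
      by (simp add: bij_betw_def)
  qed
  also have "F (N+1) = - (m (N+1) * (r * f r)) *\<^sub>R unit_vec (a k)"
  proof -
    have "norm (unit_vec (a k)) = 1"
      by (simp add: norm_eq_1 inner_unit_vec)
    then show ?thesis
      using \<open>r > 0\<close> unfolding F_def Q0 polar[OF k] by simp
  qed
  finally have eq: "- (A\<^sup>2 * r) *\<^sub>R unit_vec (a k) =
      - (m (N+1) * (r * f r)) *\<^sub>R unit_vec (a k) + (\<Sum>l\<in>{1..N} - {k}. F (\<tau> l))"
    by (simp add: polar[OF k])
  have F: "F (\<tau> l) = (m (\<tau> l) * f (2 * r * \<bar>sin ((a l - a k) / 2)\<bar>) * r) *\<^sub>R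
      (unit_vec (a l) - unit_vec (a k))" if "l \<in> {1..N} - {k}" for l
    using that \<open>r > 0\<close> k
    by (simp add: F_def polar norm_unit_vec_diff scaleR_right_diff_distrib)
  \<comment> \<open>The minus sign counts attraction towards the centre as positive, since
    \<open>unit_vec (a k)\<close> points outward.\<close>
  have "(\<Sum>l\<in>{1..N} - {k}. m (\<tau> l) * radial_force f r ((a l - a k) / 2))
      = - ((\<Sum>l\<in>{1..N} - {k}. F (\<tau> l)) \<bullet> unit_vec (a k))"
    unfolding inner_sum_left sum_negf[symmetric]
  proof (rule sum.cong)
    fix l assume "l \<in> {1..N} - {k}"
    show "m (\<tau> l) * radial_force f r ((a l - a k) / 2) = - (F (\<tau> l) \<bullet> unit_vec (a k))"
      unfolding F[OF \<open>l \<in> _\<close>]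
      by (simp add: inner_diff_left inner_unit_vec radial_force_def
          cos_double_half[of "a l - a k"])
  qed simp
  also have "\<dots> = A\<^sup>2 * r - m (N+1) * (r * f r)"
    using arg_cong[OF eq, of "\<lambda>x. x \<bullet> unit_vec (a k)"]
    by (simp add: inner_add_left inner_diff_left inner_unit_vec)
  finally show "(\<Sum>l\<in>{1..N} - {k}. m (\<tau> l) * radial_force f r ((a l - a k) / 2))
      = A\<^sup>2 * r - m (N+1) * (r * f r)" .
  have "(\<Sum>l\<in>{1..N} - {k}. m (\<tau> l) * tangential_force f r ((a l - a k) / 2))
      = (\<Sum>l\<in>{1..N} - {k}. F (\<tau> l)) \<bullet> unit_vec (a k + pi / 2)"
    unfolding inner_sum_left
  proof (rule sum.cong)
    fix l assume "l \<in> {1..N} - {k}"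
    have double: "2 * ((a l - a k) / 2) = a l - a k"
      by simp
    have "cos (a l - (a k + pi / 2)) = sin (a l - a k)" "cos (a k - (a k + pi / 2)) = 0"
      by (simp_all add: cos_diff sin_diff cos_add sin_add)
    then show "m (\<tau> l) * tangential_force f r ((a l - a k) / 2) = F (\<tau> l) \<bullet> unit_vec (a k + pi / 2)"
      unfolding F[OF \<open>l \<in> _\<close>] tangential_force_def double
      by (simp add: inner_diff_left inner_unit_vec)
  qed simp
  also have "\<dots> = 0"
    using arg_cong[OF eq, of "\<lambda>x. x \<bullet> unit_vec (a k + pi / 2)"]
    by (simp add: inner_add_left inner_diff_left inner_unit_vec)
  finally show "(\<Sum>l\<in>{1..N} - {k}. m (\<tau> l) * tangential_force f r ((a l - a k) / 2)) = 0" .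
qed

section \<open>Strict concavity of sine and the inequality for one pair\<close>

lemma sin_less_tangent:
  fixes s t :: real
  assumes "0 < s" "s < pi" "0 < t" "t < pi" "s \<noteq> t"
  shows "sin s < sin t + cos t * (s - t)"
proof (cases "s < t")
  case True
  \<comment> \<open>Since \<open>cos\<close> decreases strictly on [0, pi], the secant slope
    \<open>cos z\<close> exceeds the tangent slope \<open>cos t\<close>; in the other case it is
    smaller.\<close>
  obtain z where z: "s < z" "z < t" "sin t - sin s = (t - s) * cos z"
    using MVT2[OF True, of sin cos] by (auto intro: DERIV_sin)
  then have "cos t < cos z"
    using assms by (intro cos_monotone_0_pi) auto
  then have "cos t * (t - s) < cos z * (t - s)"
    using True by (intro mult_strict_right_mono) auto
  then show ?thesis
    using z(3) by (simp add: algebra_simps)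
next
  case False
  then have "t < s"
    using assms by simp
  obtain z where z: "t < z" "z < s" "sin s - sin t = (s - t) * cos z"
    using MVT2[OF \<open>t < s\<close>, of sin cos] by (auto intro: DERIV_sin)
  then have "cos z < cos t"
    using assms by (intro cos_monotone_0_pi) auto
  then have "cos z * (s - t) < cos t * (s - t)"
    using \<open>t < s\<close> by (intro mult_strict_right_mono) auto
  then show ?thesis
    using z(3) by (simp add: algebra_simps)
qed

text \<open>Half the lower bound that the two tangent estimates give for
  \<open>(G' - G) * (D' - D)\<close>, with \<open>D\<close>, \<open>D'\<close> the distances and
  \<open>G\<close>, \<open>G'\<close> the values of \<open>x * f x\<close> there. The radii appear
  crosswise because the tangent at \<open>t\<close> estimates \<open>sin t'\<close>, which carries
  the factor \<open>r'\<close>, and conversely.\<close>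

definition pair_defect :: "(real \<Rightarrow> real) \<Rightarrow> real \<Rightarrow> real \<Rightarrow> real \<Rightarrow> real \<Rightarrow> real" where
  "pair_defect f r t r' t' =
     (r' - r) * (radial_force f r' t' - radial_force f r t) +
     (t' - t) * (r * tangential_force f r' t' - r' * tangential_force f r t)"

text \<open>By parity of the force components; it makes the defect independent of the order in which
  the two bodies are taken.\<close>

lemma pair_defect_minus: "pair_defect f r (- t) r' (- t') = pair_defect f r t r' t'"
  by (simp add: pair_defect_def radial_force_def tangential_force_def algebra_simps)

text \<open>Twice the defect is a product that is nonpositive by monotonicity, minus two tangent
  gaps with positive weights. Strictness comes from the gaps alone, as \<open>x * f x\<close> may be
  constant on intervals.\<close>

lemma pair_defect_sign:
  assumes f_pos: "\<And>x. x > 0 \<Longrightarrow> f x > 0"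
    and mono: "antimono_on {0<..} (\<lambda>x. x * f x)"
    and "r > 0" "r' > 0" and t: "0 < t" "t < pi" "0 < t'" "t' < pi"
  shows "pair_defect f r t r' t' \<le> 0" and "t' \<noteq> t \<Longrightarrow> pair_defect f r t r' t' < 0"
proof -
  define D D' where "D = 2 * r * sin t" and "D' = 2 * r' * sin t'"
  define G G' where "G = D * f D" and "G' = D' * f D'"
  have s: "sin t > 0" "sin t' > 0"
    using t by (auto intro: sin_gt_zero)
  have D: "D > 0" "D' > 0"
    using s assms by (auto simp: D_def D'_def)
  have G: "G > 0" "G' > 0"
    using D f_pos by (auto simp: G_def G'_def)
  have rad: "radial_force f r t = G * sin t" "radial_force f r' t' = G' * sin t'"
    using s by (simp_all add: radial_force_def G_def G'_def D_def D'_def power2_eq_square)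
  have tan: "tangential_force f r t = G * cos t" "tangential_force f r' t' = G' * cos t'"
    using s by (simp_all add: tangential_force_def G_def G'_def D_def D'_def sin_double)
  have le0: "(G' - G) * (D' - D) \<le> 0"
  proof (cases "D \<le> D'")
    case True
    then have "G' \<le> G"
      using monotone_onD[OF mono, of D D'] D by (simp add: G_def G'_def)
    with True show ?thesis
      by (simp add: mult_nonpos_nonneg)
  next
    case False
    then have "G \<le> G'"
      using monotone_onD[OF mono, of D' D] D by (simp add: G_def G'_def)
    with False show ?thesis
      by (simp add: mult_nonneg_nonpos)
  qed
  have split: "2 * pair_defect f r t r' t' = (G' - G) * (D' - D)
      - 2 * r' * G * (sin t + cos t * (t' - t) - sin t')
      - 2 * r * G' * (sin t' + cos t' * (t - t') - sin t)"
    by (simp add: pair_defect_def rad tan D_def D'_def algebra_simps)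
  show less: "pair_defect f r t r' t' < 0" if "t' \<noteq> t"
  proof -
    have "0 < 2 * r' * G * (sin t + cos t * (t' - t) - sin t')"
      using sin_less_tangent[of t' t] t that G assms by simp
    moreover have "0 < 2 * r * G' * (sin t' + cos t' * (t - t') - sin t)"
      using sin_less_tangent[of t t'] t that G assms by simp
    ultimately show ?thesis
      using split le0 by linarith
  qed
  show "pair_defect f r t r' t' \<le> 0"
  proof (cases "t' = t")
    case True
    with split le0 show ?thesis by simp
  qed (use less in auto)
qed

section \<open>Summation over all pairs and rigidity\<close>

lemma sum_nonpos_0:
  fixes h :: "'i \<Rightarrow> 'b::ordered_ab_group_add"
  assumes "finite I" "\<And>i. i \<in> I \<Longrightarrow> h i \<le> 0" "sum h I = 0" "i \<in> I"
  shows "h i = 0"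
  using sum_nonneg_0[of I "\<lambda>i. - h i" i] assms by (simp add: sum_negf)

lemma sum_offdiag_swap:
  assumes "finite I"
  shows "(\<Sum>k\<in>I. \<Sum>l\<in>I - {k}. h k l) = (\<Sum>k\<in>I. \<Sum>l\<in>I - {k}. h l k)"
proof -
  have "(\<Sum>k\<in>I. \<Sum>l\<in>I - {k}. h k l) = (\<Sum>k\<in>I. \<Sum>l | l \<in> I \<and> k \<noteq> l. h k l)"
    by (intro sum.cong) auto
  also have "\<dots> = (\<Sum>k\<in>I. \<Sum>l | l \<in> I \<and> l \<noteq> k. h l k)"
    by (rule sum.swap_restrict[OF assms assms])
  also have "\<dots> = (\<Sum>k\<in>I. \<Sum>l\<in>I - {k}. h l k)"
    by (intro sum.cong) auto
  finally show ?thesis .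
qed

text \<open>The part with \<open>\<delta> k\<close> vanishes row by row, by balance at
  \<open>k\<close>. Exchanging the indices and using antisymmetry of \<open>T\<close> turns the part
  with \<open>\<delta> l\<close> into the negative of the former.\<close>

lemma tangential_sum_zero:
  fixes \<mu> \<delta> :: "'i \<Rightarrow> real"
  assumes "finite I"
    and anti: "\<And>k l. T l k = - T k l"
    and zero: "\<And>k. k \<in> I \<Longrightarrow> (\<Sum>l\<in>I - {k}. \<mu> l * T k l) = 0"
  shows "(\<Sum>k\<in>I. \<Sum>l\<in>I - {k}. \<mu> k * \<mu> l * ((\<delta> l - \<delta> k) * T k l)) = 0"
proof -
  have *: "(\<Sum>k\<in>I. \<Sum>l\<in>I - {k}. \<mu> k * \<mu> l * (\<delta> k * T k l)) = 0"
  proof (rule sum.neutral, rule ballI)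
    fix k assume "k \<in> I"
    have "(\<Sum>l\<in>I - {k}. \<mu> k * \<mu> l * (\<delta> k * T k l)) = \<mu> k * \<delta> k * (\<Sum>l\<in>I - {k}. \<mu> l * T k l)"
      by (simp add: sum_distrib_left algebra_simps)
    then show "(\<Sum>l\<in>I - {k}. \<mu> k * \<mu> l * (\<delta> k * T k l)) = 0"
      using zero[OF \<open>k \<in> I\<close>] by simp
  qed
  have "(\<Sum>k\<in>I. \<Sum>l\<in>I - {k}. \<mu> k * \<mu> l * (\<delta> l * T k l))
      = (\<Sum>k\<in>I. \<Sum>l\<in>I - {k}. \<mu> l * \<mu> k * (\<delta> k * T l k))"
    by (rule sum_offdiag_swap[OF assms(1)])
  also have "\<dots> = - (\<Sum>k\<in>I. \<Sum>l\<in>I - {k}. \<mu> k * \<mu> l * (\<delta> k * T k l))"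
    by (subst anti) (simp add: sum_negf mult.commute)
  finally show ?thesis
    using * by (simp add: left_diff_distrib right_diff_distrib sum_subtractf)
qed

text \<open>The common order enters here: for \<open>k < l\<close> both half differences lie
  strictly between 0 and pi, as \<open>pair_defect_sign\<close> requires. With different orders they
  could have opposite signs.\<close>

lemma circle_rigidity:
  fixes \<mu> a a' :: "nat \<Rightarrow> real"
  assumes f_pos: "\<And>x. x > 0 \<Longrightarrow> f x > 0"
    and mono: "antimono_on {0<..} (\<lambda>x. x * f x)"
    and "A > 0" "m\<^sub>0 > 0" and \<mu>: "\<And>k. k \<in> I \<Longrightarrow> \<mu> k > 0"
    and "finite I" "I \<noteq> {}"
    and r: "r > 0" "r' > 0"
    and order: "\<And>k l. k \<in> I \<Longrightarrow> l \<in> I \<Longrightarrow> k < l \<Longrightarrow> a k < a l \<and> a l < a k + 2 * pi"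
      "\<And>k l. k \<in> I \<Longrightarrow> l \<in> I \<Longrightarrow> k < l \<Longrightarrow> a' k < a' l \<and> a' l < a' k + 2 * pi"
    and radial:
      "\<And>k. k \<in> I \<Longrightarrow> (\<Sum>l\<in>I - {k}. \<mu> l * radial_force f r ((a l - a k) / 2)) = A\<^sup>2 * r - m\<^sub>0 * (r * f r)"
      "\<And>k. k \<in> I \<Longrightarrow> (\<Sum>l\<in>I - {k}. \<mu> l * radial_force f r' ((a' l - a' k) / 2)) = A\<^sup>2 * r' - m\<^sub>0 * (r' * f r')"
    and tangential:
      "\<And>k. k \<in> I \<Longrightarrow> (\<Sum>l\<in>I - {k}. \<mu> l * tangential_force f r ((a l - a k) / 2)) = 0"
      "\<And>k. k \<in> I \<Longrightarrow> (\<Sum>l\<in>I - {k}. \<mu> l * tangential_force f r' ((a' l - a' k) / 2)) = 0"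
  shows "r' = r \<and> (\<forall>k\<in>I. \<forall>l\<in>I. a' l - a' k = a l - a k)"
proof -
  define R where "R k l = radial_force f r ((a l - a k) / 2)" for k l
  define R' where "R' k l = radial_force f r' ((a' l - a' k) / 2)" for k l
  define T where "T k l = tangential_force f r ((a l - a k) / 2)" for k l
  define T' where "T' k l = tangential_force f r' ((a' l - a' k) / 2)" for k l
  \<comment> \<open>Half the change of each angle, so that \<open>t' - t\<close> for the pair
    \<open>k\<close>, \<open>l\<close> is \<open>\<delta> l - \<delta> k\<close>.\<close>
  define \<delta> where "\<delta> k = (a' k - a k) / 2" for k
  define e where "e k l = pair_defect f r ((a l - a k) / 2) r' ((a' l - a' k) / 2)" for k l
  have e_sym: "e l k = e k l" for k l
    using pair_defect_minus[of f r "(a l - a k) / 2" r' "(a' l - a' k) / 2"]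
    unfolding e_def minus_divide_left minus_diff_eq .
  have e_less: "e k l < 0" if "k \<in> I" "l \<in> I" "k < l" "a' l - a' k \<noteq> a l - a k" for k l
    unfolding e_def using order[OF that(1-3)] that(4) r
    by (intro pair_defect_sign(2) f_pos mono) auto
  have e_le_aux: "e k l \<le> 0" if "k \<in> I" "l \<in> I" "k < l" for k l
    unfolding e_def using order[OF that] r
    by (intro pair_defect_sign(1) f_pos mono) auto
  have e_le: "e k l \<le> 0" if "k \<in> I" "l \<in> I" "k \<noteq> l" for k l
  proof (cases "k < l")
    case True
    with e_le_aux that show ?thesis by simp
  next
    case False
    with e_le_aux[of l k] e_sym[of l k] that show ?thesis by simp
  qed
  have e_split: "e k l = (r' - r) * (R' k l - R k l) + r * ((\<delta> l - \<delta> k) * T' k l)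
      - r' * ((\<delta> l - \<delta> k) * T k l)" for k l
    by (simp add: e_def pair_defect_def R_def R'_def T_def T'_def \<delta>_def
        diff_divide_distrib algebra_simps)
  have tang0: "(\<Sum>k\<in>I. \<Sum>l\<in>I - {k}. \<mu> k * \<mu> l * ((\<delta> l - \<delta> k) * T k l)) = 0"
  proof (rule tangential_sum_zero[OF \<open>finite I\<close>])
    show "T l k = - T k l" for k l
      using sin_minus[of "(a k - a l) / 2"] sin_minus[of "a k - a l"]
      by (simp add: T_def tangential_force_def diff_divide_distrib)
  qed (use tangential in \<open>simp add: T_def\<close>)
  have tang0': "(\<Sum>k\<in>I. \<Sum>l\<in>I - {k}. \<mu> k * \<mu> l * ((\<delta> l - \<delta> k) * T' k l)) = 0"
  proof (rule tangential_sum_zero[OF \<open>finite I\<close>])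
    show "T' l k = - T' k l" for k l
      using sin_minus[of "(a' k - a' l) / 2"] sin_minus[of "a' k - a' l"]
      by (simp add: T'_def tangential_force_def diff_divide_distrib)
  qed (use tangential in \<open>simp add: T'_def\<close>)
  \<comment> \<open>The difference of the right-hand sides of the two radial equations. It does not
    depend on \<open>k\<close>, so the total mass factors out.\<close>
  define K where "K = A\<^sup>2 * (r' - r) - m\<^sub>0 * (r' * f r' - r * f r)"
  have rad: "(\<Sum>k\<in>I. \<Sum>l\<in>I - {k}. \<mu> k * \<mu> l * (R' k l - R k l)) = (\<Sum>k\<in>I. \<mu> k) * K"
    unfolding sum_distrib_right
  proof (rule sum.cong)
    fix k assume "k \<in> I"
    have "(\<Sum>l\<in>I - {k}. \<mu> k * \<mu> l * (R' k l - R k l))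
        = \<mu> k * ((\<Sum>l\<in>I - {k}. \<mu> l * R' k l) - (\<Sum>l\<in>I - {k}. \<mu> l * R k l))"
      by (simp add: sum_distrib_left sum_subtractf algebra_simps)
    also have "\<dots> = \<mu> k * K"
      unfolding R_def R'_def K_def radial[OF \<open>k \<in> I\<close>] by (simp add: algebra_simps)
    finally show "(\<Sum>l\<in>I - {k}. \<mu> k * \<mu> l * (R' k l - R k l)) = \<mu> k * K" .
  qed simp
  have "(\<Sum>k\<in>I. \<Sum>l\<in>I - {k}. \<mu> k * \<mu> l * e k l)
      = (r' - r) * (\<Sum>k\<in>I. \<Sum>l\<in>I - {k}. \<mu> k * \<mu> l * (R' k l - R k l))
      + r * (\<Sum>k\<in>I. \<Sum>l\<in>I - {k}. \<mu> k * \<mu> l * ((\<delta> l - \<delta> k) * T' k l))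
      - r' * (\<Sum>k\<in>I. \<Sum>l\<in>I - {k}. \<mu> k * \<mu> l * ((\<delta> l - \<delta> k) * T k l))"
    unfolding e_split sum_distrib_left sum.distrib[symmetric] sum_subtractf[symmetric]
    by (intro sum.cong refl) (simp add: algebra_simps)
  then have sum_e: "(\<Sum>k\<in>I. \<Sum>l\<in>I - {k}. \<mu> k * \<mu> l * e k l) = (\<Sum>k\<in>I. \<mu> k) * ((r' - r) * K)"
    unfolding tang0 tang0' rad by simp
  have M: "(\<Sum>k\<in>I. \<mu> k) > 0"
    using \<mu> \<open>finite I\<close> \<open>I \<noteq> {}\<close> by (intro sum_pos)
  \<comment> \<open>The same monotonicity, now at the distances \<open>r\<close> and
    \<open>r'\<close> from the central body, gives its contribution to \<open>(r' - r) * K\<close>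
    the favourable sign.\<close>
  have "(r' - r) * (r' * f r' - r * f r) \<le> 0"
  proof (cases "r \<le> r'")
    case True
    then show ?thesis
      using monotone_onD[OF mono, of r r'] r by (simp add: mult_nonneg_nonpos)
  next
    case False
    then show ?thesis
      using monotone_onD[OF mono, of r' r] r by (simp add: mult_nonpos_nonneg)
  qed
  then have "m\<^sub>0 * ((r' - r) * (r' * f r' - r * f r)) \<le> 0"
    using \<open>m\<^sub>0 > 0\<close> by (simp add: mult_nonneg_nonpos)
  then have K_ge: "A\<^sup>2 * (r' - r)\<^sup>2 \<le> (r' - r) * K"
    by (simp add: K_def algebra_simps power2_eq_square)
  have term_le: "\<mu> k * \<mu> l * e k l \<le> 0" if "k \<in> I" "l \<in> I - {k}" for k l
    using \<mu>[of k] \<mu>[of l] e_le[of k l] that by (intro mult_nonneg_nonpos mult_nonneg_nonneg) auto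
  have row_le: "(\<Sum>l\<in>I - {k}. \<mu> k * \<mu> l * e k l) \<le> 0" if "k \<in> I" for k
    using term_le[OF that] by (intro sum_nonpos)
  have "(\<Sum>k\<in>I. \<mu> k) * ((r' - r) * K) \<le> 0"
    unfolding sum_e[symmetric] by (intro sum_nonpos row_le)
  then have K_le: "(r' - r) * K \<le> 0"
    using M by (simp add: mult_le_0_iff)
  \<comment> \<open>Now \<open>(r' - r) * K\<close> is squeezed: at most 0, and at least
    \<open>A\<^sup>2 * (r' - r)\<^sup>2\<close>.\<close>
  have nonneg: "0 \<le> A\<^sup>2 * (r' - r)\<^sup>2"
    by simp
  then have "A\<^sup>2 * (r' - r)\<^sup>2 = 0"
    using K_ge K_le by linarith
  then have "r' = r"
    using \<open>A > 0\<close> by simp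
  \<comment> \<open>With equal radii a sum of nonpositive terms is 0, so each defect vanishes; by
    \<open>e_less\<close> no angular difference can then have changed.\<close>
  have "(\<Sum>k\<in>I. \<Sum>l\<in>I - {k}. \<mu> k * \<mu> l * e k l) = 0"
    unfolding sum_e using \<open>r' = r\<close> by simp
  then have row0: "(\<Sum>l\<in>I - {k}. \<mu> k * \<mu> l * e k l) = 0" if "k \<in> I" for k
    by (intro sum_nonpos_0[OF \<open>finite I\<close> row_le _ that])
  have e0: "e k l = 0" if "k \<in> I" "l \<in> I - {k}" for k l
  proof -
    have "\<mu> k * \<mu> l * e k l = 0"
      using \<open>finite I\<close> by (intro sum_nonpos_0[OF _ term_le[OF that(1)] row0[OF that(1)] that(2)]) simp
    then show ?thesis
      using \<mu>[of k] \<mu>[of l] that by auto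
  qed
  have lt: "a' l - a' k = a l - a k" if "k \<in> I" "l \<in> I" "k < l" for k l
    using e_less[OF that] e0[of k l] that by auto
  have "a' l - a' k = a l - a k" if "k \<in> I" "l \<in> I" for k l
    using lt[of k l] lt[of l k] that by (cases k l rule: linorder_cases) auto
  with \<open>r' = r\<close> show ?thesis
    by blast
qed

section \<open>Angles from the order of the masses, and the theorem\<close>

lemma has_order_polar:
  assumes "has_order \<tau> N Q"
  obtains r a where "r > 0" "\<And>k. k \<in> {1..N} \<Longrightarrow> Q (\<tau> k) = r *\<^sub>R unit_vec (a k)"
    "\<And>k l. k \<in> {1..N} \<Longrightarrow> l \<in> {1..N} \<Longrightarrow> k < l \<Longrightarrow> a k < a l \<and> a l < a k + 2 * pi"
proof -
  obtain c r \<alpha> where *: "r > 0" "strict_mono_on {1..N} \<alpha>"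
      "\<And>k. k \<in> {1..N} \<Longrightarrow> 0 \<le> \<alpha> k \<and> \<alpha> k < 2 * pi"
      "\<And>k. k \<in> {1..N} \<Longrightarrow> rot c *v Q (\<tau> k) = r *\<^sub>R vector [cos (\<alpha> k), sin (\<alpha> k)]"
    using assms unfolding has_order_def by blast
  show thesis
  proof (rule that[OF *(1)])
    \<comment> \<open>The normalising rotation is absorbed into the angles. They may leave [0, 2
      pi), but keep their order and a spread below a full turn.\<close>
    show "Q (\<tau> k) = r *\<^sub>R unit_vec (\<alpha> k - c)" if "k \<in> {1..N}" for k
      using rot_eq_unit_vec[OF *(4)[OF that]] .
    show "\<alpha> k - c < \<alpha> l - c \<and> \<alpha> l - c < \<alpha> k - c + 2 * pi"
      if "k \<in> {1..N}" "l \<in> {1..N}" "k < l" for k l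
      using strict_mono_onD[OF *(2) that] *(3)[OF that(1)] *(3)[OF that(2)] by auto
  qed
qed

theorem theorem1p3:
  fixes N :: nat and f :: "real \<Rightarrow> real" and A :: real and m :: "nat \<Rightarrow> real"
    and \<tau> :: "nat \<Rightarrow> nat"
    and Q Q' :: "nat \<Rightarrow> real^2" and q q' :: "nat \<Rightarrow> real \<Rightarrow> real^2"
  assumes "N \<ge> 1"
    and "\<And>x. x > 0 \<Longrightarrow> f x > 0"
    and "antimono_on {0<..} (\<lambda>x. x * f x)"
    and "(\<lambda>x. x * f x) differentiable_on {0<..}"
    and "A > 0"
    and "\<And>i. i \<in> {1..N+1} \<Longrightarrow> m i > 0"
    and "\<tau> permutes {1..N}"
    and "relative_equilibrium f m (N+1) A Q q" and "center_of_mass m (N+1) Q = 0"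
    and "on_centered_circle N q" and "\<And>t. q (N+1) t = 0" and "has_order \<tau> N Q"
    and "relative_equilibrium f m (N+1) A Q' q'" and "center_of_mass m (N+1) Q' = 0"
    and "on_centered_circle N q'" and "\<And>t. q' (N+1) t = 0" and "has_order \<tau> N Q'"
  shows "rotation_equivalent (N+1) q q'"
proof -
  obtain r a where r: "r > 0" and polar: "\<And>k. k \<in> {1..N} \<Longrightarrow> Q (\<tau> k) = r *\<^sub>R unit_vec (a k)"
    and a: "\<And>k l. k \<in> {1..N} \<Longrightarrow> l \<in> {1..N} \<Longrightarrow> k < l \<Longrightarrow> a k < a l \<and> a l < a k + 2 * pi"
    using has_order_polar[OF assms(12)] by blast
  obtain r' a' where r': "r' > 0" and polar': "\<And>k. k \<in> {1..N} \<Longrightarrow> Q' (\<tau> k) = r' *\<^sub>R unit_vec (a' k)"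
    and a': "\<And>k l. k \<in> {1..N} \<Longrightarrow> l \<in> {1..N} \<Longrightarrow> k < l \<Longrightarrow> a' k < a' l \<and> a' l < a' k + 2 * pi"
    using has_order_polar[OF assms(17)] by blast
  have \<mu>: "m (\<tau> k) > 0" if "k \<in> {1..N}" for k
    using permutes_in_image[OF assms(7), of k] that assms(6)[of "\<tau> k"] by simp
  note eqs = circle_equations[OF assms(8,9,11,7) r polar]
    and eqs' = circle_equations[OF assms(13,14,16,7) r' polar']
  have rigid: "r' = r \<and> (\<forall>k\<in>{1..N}. \<forall>l\<in>{1..N}. a' l - a' k = a l - a k)"
  proof (rule circle_rigidity[OF assms(2,3,5) _ \<mu> _ _ r r' a a' eqs(1) eqs'(1) eqs(2) eqs'(2)])
    show "m (N+1) > 0" "finite {1..N}" "{1..N} \<noteq> {}"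
      using assms(1,6) by auto
  qed
  \<comment> \<open>The shift at position 1, which exists as \<open>N \<ge> 1\<close>; by rigidity
    every position has the same shift.\<close>
  define c where "c = a' 1 - a 1"
  have Q': "Q' i = rot c *v Q i" if "i \<in> {1..N}" for i
  proof -
    have "i \<in> \<tau> ` {1..N}"
      using that permutes_image[OF assms(7)] by simp
    then obtain k where k: "k \<in> {1..N}" "i = \<tau> k"
      by (rule imageE) auto
    have "a' k - a' 1 = a k - a 1"
      using rigid k(1) assms(1) by simp
    then have "a' k = a k + c"
      by (simp add: c_def)
    then show ?thesis
      using rigid polar[OF k(1)] polar'[OF k(1)] k(2) by (simp add: matrix_vector_mult_scaleR rot_unit_vec)
  qed
  have "q' i t = rot c *v q i t" if "i \<in> {1..N+1}" for i t
  proof (cases "i = N+1")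
    case True
    then show ?thesis
      using assms(11)[of t] assms(16)[of t] by simp
  next
    case False
    \<comment> \<open>Plane rotations commute, so the rotation relating \<open>Q\<close> to
      \<open>Q'\<close> relates the orbits at every time.\<close>
    have "q i t = rot (A * t) *v Q i" "q' i t = rot (A * t) *v Q' i"
      using assms(8,9,13,14) that by (simp_all add: relative_equilibrium_def)
    then show ?thesis
      using Q'[of i] False that by (simp add: rot_rot add.commute)
  qed
  then show ?thesis
    unfolding rotation_equivalent_def by blast
qed

end
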